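(* Let $W$ be a set of proper weights on $\mathbb{R}^d$ and let $x\in\mathbb{R}^d$. Then $x$ is $W$-singular if and only if the orbit $\mathcal{A}_W^+\pi(u_x)$ diverges in $X=\mathrm{SL}_{d+1}(\mathbb{R})/\mathrm{SL}_{d+1}(\mathbb{Z})$, i.e. for every compact $K\subset X$ there is a compact $\tilde A\subset\mathcal{A}_W^+$ such that $a\pi(u_x)\notin K$ for all $a\in\mathcal{A}_W^+\setminus\tilde A$.
   Context: A weight is $w=(w_1,\dots,w_d)\in[0,1]^d$ with $\sum_iw_i=1$; it is proper if $w\in(0,1)^d$. Define $\|y\|_w:=\max_{i:\,w_i\ne0}|y_i|^{1/w_i}$. A vector $x\in\mathbb{R}^d$ is $W$-singular if for every $\delta>0$ there exists $Q_0>0$ such that for every $Q>Q_0$ and every $w\in W$ there is $(p,q)\in\mathbb{Z}^d\times\mathbb{N}$ with $\|qx-p\|_w\le\delta/Q$ and $0<q\le Q$. $X$ is identified with the space of unimodular lattices in $\mathbb{R}^{d+1}$ via $\pi(g)=g\mathbb{Z}^{d+1}$. Set $a_{w,t}:=\mathrm{diag}(e^{w_1t},\dots,e^{w_dt},e^{-t})$, $\mathcal{A}_W^+:=\{a_{w,t}:w\in W,\ t\ge0\}$ (with the topology induced from $\mathrm{SL}_{d+1}(\mathbb{R})$), and $u_x:=\begin{pmatrix}I_d & x^T\\ 0&1\end{pmatrix}$.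
   Formalization: The set W of proper weights is assumed compact; for non-compact W the equivalence fails, since x = 0 is W-singular while no orbit under A_W^+ diverges in the stated sense. *)

theory Defs
  imports "HOL-Analysis.Analysis"
begin

section \<open>Weights and singular vectors\<close>

definition weight :: "real ^ 'd \<Rightarrow> bool" where
  "weight w \<longleftrightarrow> (\<forall>i. 0 \<le> w $ i \<and> w $ i \<le> 1) \<and> (\<Sum>i\<in>UNIV. w $ i) = 1"

definition proper_weight :: "real ^ 'd \<Rightarrow> bool" where
  "proper_weight w \<longleftrightarrow> weight w \<and> (\<forall>i. 0 < w $ i \<and> w $ i < 1)"

text \<open>For a weight the set of indices below is nonempty, so that \<open>Max\<close> is meaningful.\<close>

definition wnorm :: "real ^ 'd \<Rightarrow> real ^ 'd \<Rightarrow> real" where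
  "wnorm w y = Max ((\<lambda>i. \<bar>y $ i\<bar> powr (1 / w $ i)) ` {i. w $ i \<noteq> 0})"

definition W_singular :: "(real ^ 'd) set \<Rightarrow> real ^ 'd \<Rightarrow> bool" where
  "W_singular W x \<longleftrightarrow>
    (\<forall>\<delta>>0. \<exists>Q0>0. \<forall>Q>Q0. \<forall>w\<in>W. \<exists>(p :: int ^ 'd) (q :: nat).
       wnorm w (real q *\<^sub>R x - (\<chi> i. real_of_int (p $ i))) \<le> \<delta> / Q \<and> 0 < q \<and> real q \<le> Q)"


section \<open>The space of unimodular lattices\<close>

definition SL :: "(real ^ 'n ^ 'n) set" where
  "SL = {g. det g = 1}"

definition SLZ :: "(real ^ 'n ^ 'n) set" where
  "SLZ = {g \<in> SL. \<forall>i j. g $ i $ j \<in> \<int>}"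

definition Zn :: "(real ^ 'n) set" where
  "Zn = {z. \<forall>i. z $ i \<in> \<int>}"

definition lattice_of :: "real ^ 'n ^ 'n \<Rightarrow> (real ^ 'n) set" where
  "lattice_of g = (\<lambda>z. g *v z) ` Zn"

text \<open>The points of \<open>X\<close> are the unimodular lattices \<open>lattice_of g\<close> with \<open>g \<in> SL\<close>; by
  \<open>lattice_of_eq_iff\<close> below they correspond to the left cosets of \<open>SLZ\<close> in \<open>SL\<close>.
  The topology is the quotient topology with respect to \<open>lattice_of\<close>, see
  \<open>quotient_map_lattice_of\<close>.\<close>

definition lattice_space :: "(real ^ 'n) set topology" where
  "lattice_space =
    topology (\<lambda>U. U \<subseteq> lattice_of ` SL \<and> openin (top_of_set SL) {g \<in> SL. lattice_of g \<in> U})"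

lemma openin_lattice_space:
  "openin lattice_space U \<longleftrightarrow>
     U \<subseteq> lattice_of ` (SL :: (real ^ 'n ^ 'n) set) \<and>
     openin (top_of_set SL) {g \<in> SL :: (real ^ 'n ^ 'n) set. lattice_of g \<in> U}"
proof -
  let ?P = "\<lambda>U. {g \<in> SL :: (real ^ 'n ^ 'n) set. lattice_of g \<in> U}"
  have "istopology (\<lambda>U. U \<subseteq> lattice_of ` (SL :: (real ^ 'n ^ 'n) set) \<and> openin (top_of_set SL) (?P U))"
    unfolding istopology_def
  proof (intro conjI allI impI, goal_cases)
    case (1 S T)
    then show ?case by blast
  next
    case (2 S T)
    have "?P (S \<inter> T) = ?P S \<inter> ?P T" by blast
    with 2 show ?case by (simp add: openin_Int)
  next
    case (3 \<K>)
    then show ?case by blast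
  next
    case (4 \<K>)
    have "?P (\<Union>\<K>) = \<Union>(?P ` \<K>)" by blast
    moreover have "openin (top_of_set SL) (\<Union>(?P ` \<K>))"
      using 4 by (intro openin_Union) blast
    ultimately show ?case by simp
  qed
  then show ?thesis
    unfolding lattice_space_def by simp
qed

lemma topspace_lattice_space:
  "topspace lattice_space = lattice_of ` (SL :: (real ^ 'n ^ 'n) set)"
proof -
  have "{g \<in> SL. lattice_of g \<in> lattice_of ` (SL :: (real ^ 'n ^ 'n) set)} = SL"
    by blast
  then have "openin lattice_space (lattice_of ` (SL :: (real ^ 'n ^ 'n) set))"
    unfolding openin_lattice_space by simp
  then have "lattice_of ` (SL :: (real ^ 'n ^ 'n) set) \<subseteq> topspace lattice_space"
    by (rule openin_subset)
  moreover have "topspace lattice_space \<subseteq> lattice_of ` (SL :: (real ^ 'n ^ 'n) set)"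
    using openin_topspace[of lattice_space] unfolding openin_lattice_space by (rule conjunct1)
  ultimately show ?thesis by (rule subset_antisym[rotated])
qed

lemma quotient_map_lattice_of:
  "quotient_map (top_of_set (SL :: (real ^ 'n ^ 'n) set)) lattice_space lattice_of"
  unfolding quotient_map_def by (simp add: topspace_lattice_space openin_lattice_space)

lemma Ints_det:
  fixes A :: "real ^ 'n ^ 'n"
  assumes "\<And>i j. A $ i $ j \<in> \<int>"
  shows "det A \<in> \<int>"
  unfolding det_def by (intro Ints_sum Ints_mult Ints_prod Ints_of_int assms)

lemma lattice_of_SLZ:
  fixes \<gamma> :: "real ^ 'n ^ 'n"
  assumes "\<gamma> \<in> SLZ"
  shows "lattice_of \<gamma> = Zn"
proof -
  have d: "det \<gamma> = 1" and I: "\<And>i j. \<gamma> $ i $ j \<in> \<int>"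
    using assms by (auto simp: SLZ_def SL_def)
  have "\<gamma> *v z \<in> Zn" if "z \<in> Zn" for z
    using that I by (auto simp: Zn_def matrix_vector_mult_def intro!: Ints_sum Ints_mult)
  moreover have "z \<in> lattice_of \<gamma>" if "z \<in> Zn" for z
  proof -
    define v where "v = (\<chi> k. det (\<chi> i j. if j = k then z $ i else \<gamma> $ i $ j) / det \<gamma>)"
    have "\<gamma> *v v = z"
      using cramer[of \<gamma> v z] d by (simp add: v_def)
    moreover have "v \<in> Zn"
      using that I by (auto simp: v_def Zn_def d intro!: Ints_det)
    ultimately show ?thesis by (auto simp: lattice_of_def)
  qed
  ultimately show ?thesis by (auto simp: lattice_of_def)
qed

lemma lattice_of_mult: "lattice_of (a ** g) = (\<lambda>v. a *v v) ` lattice_of g"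
  by (simp add: lattice_of_def image_image matrix_vector_mul_assoc)

lemma lattice_of_eq_iff:
  fixes g h :: "real ^ 'n ^ 'n"
  assumes g: "g \<in> SL" and h: "h \<in> SL"
  shows "lattice_of g = lattice_of h \<longleftrightarrow> (\<exists>\<gamma>\<in>SLZ. h = g ** \<gamma>)"
proof
  assume "\<exists>\<gamma>\<in>SLZ. h = g ** \<gamma>"
  then show "lattice_of g = lattice_of h"
    by (auto simp: lattice_of_mult lattice_of_SLZ) (auto simp: lattice_of_def)
next
  assume eq: "lattice_of g = lattice_of h"
  have "invertible g"
    using g by (simp add: SL_def invertible_det_nz)
  then obtain g' where g': "g' ** g = mat 1" "g ** g' = mat 1"
    by (auto simp: invertible_def)
  define \<gamma> where "\<gamma> = g' ** h"
  have h_eq: "h = g ** \<gamma>"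
    by (simp add: \<gamma>_def matrix_mul_assoc g')
  have "det \<gamma> = 1"
    using g h by (simp add: h_eq det_mul SL_def)
  moreover have "\<gamma> $ i $ j \<in> \<int>" for i j
  proof -
    have "axis j 1 \<in> Zn" by (auto simp: Zn_def axis_def)
    then have "h *v axis j 1 \<in> lattice_of g"
      unfolding eq by (auto simp: lattice_of_def)
    then obtain z where z: "z \<in> Zn" "h *v axis j 1 = g *v z"
      by (auto simp: lattice_of_def)
    have "\<gamma> *v axis j 1 = g' *v (g *v z)"
      by (simp add: \<gamma>_def z(2) flip: matrix_vector_mul_assoc)
    also have "\<dots> = z"
      by (simp add: matrix_vector_mul_assoc g')
    finally have "column j \<gamma> = z"
      by (simp add: matrix_vector_mult_basis)
    then show ?thesis
      using z(1) by (auto simp: Zn_def column_def)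
  qed
  ultimately show "\<exists>\<gamma>\<in>SLZ. h = g ** \<gamma>"
    using h_eq by (auto simp: SLZ_def SL_def)
qed


section \<open>Orbits and divergence\<close>

text \<open>The index type of \<open>\<real>\<^sup>d\<^sup>+\<^sup>1\<close> is \<^typ>\<open>'d option\<close>: \<open>Some i\<close> stands for the
  \<open>i\<close>-th coordinate of \<open>\<real>\<^sup>d\<close> and \<open>None\<close> for the last coordinate.\<close>

definition a_mat :: "real ^ 'd \<Rightarrow> real \<Rightarrow> real ^ ('d option) ^ ('d option)" where
  "a_mat w t = (\<chi> i j. if i = j then (case i of Some k \<Rightarrow> exp (w $ k * t) | None \<Rightarrow> exp (- t)) else 0)"

definition u_mat :: "real ^ 'd \<Rightarrow> real ^ ('d option) ^ ('d option)" where
  "u_mat x = (\<chi> i j. if i = j then 1 else (case (i, j) of (Some k, None) \<Rightarrow> x $ k | _ \<Rightarrow> 0))"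

definition A_plus :: "(real ^ 'd) set \<Rightarrow> (real ^ ('d option) ^ ('d option)) set" where
  "A_plus W = {a_mat w t | w t. w \<in> W \<and> 0 \<le> t}"

text \<open>Divergence of the orbit of the lattice \<open>L\<close> under a set \<open>A\<close> of matrices, where \<open>A\<close> carries
  the topology induced from the space of all matrices. A matrix \<open>a\<close> acts on lattices by taking
  images, and \<open>a\<close> applied to \<open>lattice_of g\<close> is \<open>lattice_of (a ** g)\<close> by \<open>lattice_of_mult\<close>.\<close>

definition orbit_diverges :: "(real ^ 'n ^ 'n) set \<Rightarrow> (real ^ 'n) set \<Rightarrow> bool" where
  "orbit_diverges A L \<longleftrightarrow>
    (\<forall>K. compactin lattice_space K \<longrightarrow>
      (\<exists>A'. compactin (top_of_set A) A' \<and> (\<forall>a \<in> A - A'. (\<lambda>v. a *v v) ` L \<notin> K)))"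

text \<open>Pitfall: if \<open>W\<close> is a set of proper weights that is not compact, then \<open>0\<close> is
  \<open>W\<close>-singular (take \<open>p = 0\<close>, \<open>q = 1\<close>), but its orbit under \<open>A_plus W\<close> does not diverge:
  for \<open>K\<close> the compact set of all \<open>lattice_of (a_mat v 1)\<close> with \<open>v\<close> in the closure of \<open>W\<close>, the
  exceptional set has to contain \<open>a_mat w 1\<close> for all \<open>w \<in> W\<close>, and these have limit points
  outside \<open>A_plus W\<close>. So singularity and divergence can only agree for all \<open>x\<close> if \<open>W\<close> is compact.\<close>

end

theory Submission
  imports Defs "HOL-Combinatorics.Permutations"
begin

text \<open>With \<open>Q\<close> equal to \<open>e\<^sup>t\<close> up to a constant factor, an integer solution \<open>(p, q)\<close> of the inequalities
  for the weight \<open>w\<close> is the same thing as a short nonzero vector of the lattice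
  \<open>a\<^bsub>w,t\<^esub> u\<^sub>x \<int>\<^sup>d\<^sup>+\<^sup>1\<close>; compactness of \<open>W\<close> keeps the weights away from \<open>0\<close>, which makes the comparison
  of the constants uniform. The statement then reduces to Mahler's criterion: a family of unimodular
  lattices is relatively compact if and only if their nonzero vectors are bounded away from \<open>0\<close>.

  For the hard half of Mahler's criterion, Minkowski's theorem for an ellipsoid that is
  very long in one direction \<open>u\<close> shows that the lattice vectors of bounded length cannot all be orthogonal to
  \<open>u\<close>, so they span. Hence \<open>g M\<close> is bounded for some integer matrix \<open>M\<close> with nonzero bounded
  determinant. There are only finitely many such \<open>M\<close> up to left multiplication by \<open>SL(n, \<int>)\<close>, and so
  \<open>g \<gamma>\<close> is bounded for some \<open>\<gamma> \<in> SL(n, \<int>)\<close>.\<close>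

section \<open>Minkowski's theorem for balls\<close>

text \<open>The change of variables formula of the library is restricted to well-ordered index types, which
  \<open>'d option\<close> is not. The copy \<open>'a wo\<close> of a finite type carries an arbitrary well-order.\<close>

typedef 'a wo = "UNIV :: 'a set" ..

instance wo :: (finite) finite
proof
  have "(UNIV :: 'a wo set) = range Abs_wo"
    by (metis Abs_wo_cases surj_def)
  then show "finite (UNIV :: 'a wo set)"
    by (metis finite finite_imageI)
qed

text \<open>Pulling the order of the naturals back along an arbitrary injection yields a relation
  that is total and well-founded at once.\<close>

definition wo_rank :: "'a::finite wo \<Rightarrow> nat" where
  "wo_rank = (SOME f. inj f)"

lemma inj_wo_rank: "inj wo_rank"
proof -
  have "\<exists>f :: 'a wo \<Rightarrow> nat. inj f"
    using finite_imp_inj_to_nat_seg[OF finite[of UNIV]] by blast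
  then show ?thesis
    unfolding wo_rank_def by (rule someI_ex)
qed

instantiation wo :: (finite) wellorder
begin

definition less_eq_wo :: "'a wo \<Rightarrow> 'a wo \<Rightarrow> bool" where
  "less_eq_wo x y \<longleftrightarrow> wo_rank x \<le> wo_rank y"

definition less_wo :: "'a wo \<Rightarrow> 'a wo \<Rightarrow> bool" where
  "less_wo x y \<longleftrightarrow> wo_rank x < wo_rank y"

instance
proof
  fix x y :: "'a wo"
  assume "x \<le> y" "y \<le> x"
  then show "x = y"
    using inj_wo_rank by (auto simp: less_eq_wo_def dest: injD)
next
  fix P :: "'a wo \<Rightarrow> bool" and a
  assume step: "\<And>x. (\<And>y. y < x \<Longrightarrow> P y) \<Longrightarrow> P x"
  show "P a"
  proof (induction a rule: measure_induct_rule[of wo_rank])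
    case (less x)
    show ?case
      by (rule step) (simp only: less_wo_def less)
  qed
qed (auto simp: less_eq_wo_def less_wo_def)

end

text \<open>Conjugation by \<open>f\<close> is a sign-preserving bijection between the permutations
  of the two index types, and it matches the terms of the two Leibniz sums. This carries
  determinants over from \<open>'n\<close> to the well-ordered copy \<open>'n wo\<close>.\<close>

lemma det_reindex:
  fixes f :: "'m::finite \<Rightarrow> 'n::finite" and h :: "real ^ 'n ^ 'n"
  assumes "bij f"
  shows "det (\<chi> i j. h $ f i $ f j) = det h"
proof -
  have inj: "inj f" using assms by (rule bij_is_inj)
  have bp: "bij_betw (map_permutation UNIV f) {p. p permutes UNIV} {p. p permutes UNIV}"
  proof (rule bij_betw_byWitness[where f' = "map_permutation UNIV (inv f)"])
    show "\<forall>p\<in>{p. p permutes UNIV}. map_permutation UNIV (inv f) (map_permutation UNIV f p) = p"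
      using assms by (auto intro!: map_permutation_compose_inv simp: bij_is_inj inv_f_f)
    show "\<forall>p\<in>{p. p permutes UNIV}. map_permutation UNIV f (map_permutation UNIV (inv f) p) = p"
      using assms by (auto intro!: map_permutation_compose_inv simp: bij_imp_bij_inv bij_is_surj surj_f_inv_f)
    show "map_permutation UNIV f ` {p. p permutes UNIV} \<subseteq> {p. p permutes UNIV}"
      using assms by (auto intro: map_permutation_permutes)
    show "map_permutation UNIV (inv f) ` {p. p permutes UNIV} \<subseteq> {p. p permutes UNIV}"
      using assms by (auto intro!: map_permutation_permutes bij_imp_bij_inv)
  qed
  have "of_int (sign p) * (\<Prod>i\<in>UNIV. (\<chi> i j. h $ f i $ f j) $ i $ p i) =
      of_int (sign (map_permutation UNIV f p)) * (\<Prod>i\<in>UNIV. h $ i $ map_permutation UNIV f p i)"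
    if "p permutes UNIV" for p
  proof -
    have "(\<Prod>i\<in>UNIV. h $ i $ map_permutation UNIV f p i) =
        (\<Prod>i\<in>UNIV. h $ f i $ map_permutation UNIV f p (f i))"
      by (rule prod.reindex_bij_betw[OF assms, symmetric])
    also have "\<dots> = (\<Prod>i\<in>UNIV. h $ f i $ f (p i))"
      by (simp add: map_permutation_apply[OF inj])
    finally show ?thesis
      using that inj by (simp add: sign_map_permutation)
  qed
  then have "det (\<chi> i j. h $ f i $ f j) = (\<Sum>p | p permutes UNIV.
      of_int (sign (map_permutation UNIV f p)) * (\<Prod>i\<in>UNIV. h $ i $ map_permutation UNIV f p i))"
    unfolding det_def by (intro sum.cong) auto
  also have "\<dots> = det h"
    unfolding det_def by (rule sum.reindex_bij_betw[OF bp])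
  finally show ?thesis .
qed

section \<open>Integer points and Blichfeldt's principle\<close>

lemma finite_vec_range:
  assumes "finite S"
  shows "finite {v :: 'a ^ 'n. \<forall>i. v $ i \<in> S}"
proof -
  have "{v :: 'a ^ 'n. \<forall>i. v $ i \<in> S} \<subseteq> vec_lambda ` (UNIV \<rightarrow>\<^sub>E S)"
  proof
    fix v :: "'a ^ 'n"
    assume "v \<in> {v. \<forall>i. v $ i \<in> S}"
    then have "($) v \<in> UNIV \<rightarrow>\<^sub>E S" by auto
    moreover have "v = vec_lambda (($) v)" by simp
    ultimately show "v \<in> vec_lambda ` (UNIV \<rightarrow>\<^sub>E S)" by blast
  qed
  then show ?thesis
    by (rule finite_subset) (intro finite_imageI finite_PiE assms; simp)
qed

lemma finite_Zn_bounded: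
  assumes "bounded E"
  shows "finite (Zn \<inter> (E :: (real ^ 'n) set))"
proof -
  obtain B where B: "\<And>v. v \<in> E \<Longrightarrow> norm v \<le> B"
    using assms by (auto simp: bounded_iff)
  have "Zn \<inter> E \<subseteq> {v. \<forall>i. v $ i \<in> of_int ` {-\<lceil>B\<rceil>..\<lceil>B\<rceil>}}"
  proof (intro subsetI CollectI allI)
    fix v i assume v: "v \<in> Zn \<inter> E"
    then obtain k where k: "v $ i = of_int k" by (auto simp: Zn_def elim: Ints_cases)
    have "\<bar>v $ i\<bar> \<le> B"
      using B[of v] component_le_norm_cart[of v i] v by simp
    then show "v $ i \<in> of_int ` {-\<lceil>B\<rceil>..\<lceil>B\<rceil>}"
      unfolding k by (intro imageI) (simp, linarith)
  qed
  then show ?thesis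
    by (rule finite_subset) (rule finite_vec_range, simp)
qed

text \<open>Blichfeldt's principle: cut \<open>E\<close> along the integer translates of the unit
  cube and move every piece back into the cube. By \<open>inj\<close> the moved pieces are disjoint,
  so their total measure is at most that of the cube.\<close>

lemma measure_le_1_of_disjoint_translates:
  fixes E :: "(real ^ 'n) set"
  assumes "bounded E" "E \<in> sets lebesgue"
    and inj: "\<And>v w. v \<in> E \<Longrightarrow> w \<in> E \<Longrightarrow> v - w \<in> Zn \<Longrightarrow> v = w"
  shows "measure lebesgue E \<le> 1"
proof -
  define C where "C = cbox 0 (1 :: real ^ 'n)"
  define fl where "fl v = (\<chi> i. real_of_int \<lfloor>v $ i\<rfloor>)" for v :: "real ^ 'n"
  have fl: "fl v \<in> Zn" "v - fl v \<in> C" for v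
    by (auto simp: fl_def Zn_def C_def mem_box_cart) linarith
  have C: "C \<in> lmeasurable" "measure lebesgue C = 1"
  proof -
    show "C \<in> lmeasurable" by (simp add: C_def)
    show "measure lebesgue C = 1"
      unfolding C_def by (simp add: content_cbox_cart interval_ne_empty_cart)
  qed
  define I where "I = fl ` E"
  \<comment> \<open>Only finitely many cubes meet \<open>E\<close>: their corners are integer points
    of the bounded set of differences of \<open>E\<close> and \<open>C\<close>.\<close>
  have "I \<subseteq> Zn \<inter> (\<lambda>(v, c). v - c) ` (E \<times> C)"
  proof -
    have "fl v \<in> (\<lambda>(v, c). v - c) ` (E \<times> C)" if "v \<in> E" for v
      using that fl(2)[of v] by (intro image_eqI[of _ _ "(v, v - fl v)"]) auto
    then show ?thesis using fl(1) by (auto simp: I_def)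
  qed
  moreover have "bounded ((\<lambda>(v, c). v - c) ` (E \<times> C))"
    using bounded_minus[OF \<open>bounded E\<close>, of C] by (simp add: C_def)
  ultimately have finI: "finite I"
    using finite_Zn_bounded finite_subset by blast
  have Em: "E \<in> lmeasurable"
    using assms by (simp add: bounded_set_imp_lmeasurable)
  define F where "F z = E \<inter> (+) z ` C" for z
  have F: "F z \<in> lmeasurable" for z
    unfolding F_def by (intro fmeasurable.Int Em measurable_translation C)
  define G where "G z = (+) (- z) ` F z" for z
  have G: "G z \<in> lmeasurable" "measure lebesgue (G z) = measure lebesgue (F z)" for z
    unfolding G_def by (rule measurable_translation[OF F], rule measure_translation)
  have "v \<in> F (fl v)" if "v \<in> E" for v
    unfolding F_def using that fl(2)[of v] by (intro IntI image_eqI[of _ _ "v - fl v"]) auto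
  then have "E = (\<Union>z\<in>I. F z)"
    by (auto simp: I_def) (simp add: F_def)
  \<comment> \<open>The cube \<open>C\<close> is closed, so the pieces \<open>F z\<close> may
    overlap on faces; subadditivity suffices here, and disjointness matters only for the sets
    \<open>G z\<close>.\<close>
  then have "measure lebesgue E \<le> (\<Sum>z\<in>I. measure lebesgue (F z))"
    using measure_UNION_le[OF finI, of F lebesgue] F by (simp add: fmeasurableD)
  also have "\<dots> = (\<Sum>z\<in>I. measure lebesgue (G z))"
    by (simp add: G)
  also have "\<dots> = measure lebesgue (\<Union>z\<in>I. G z)"
  proof (rule measure_UNION'[symmetric, OF finI G(1)])
    show "pairwise (\<lambda>i j. disjnt (G i) (G j)) I"
    proof (clarsimp simp: pairwise_def disjnt_iff)
      fix y z v assume "y \<in> I" "z \<in> I" "y \<noteq> z" "v \<in> G y" "v \<in> G z"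
      \<comment> \<open>A common point of two moved pieces comes from two points of \<open>E\<close>
        whose difference is the integer vector \<open>y - z\<close>.\<close>
      then have e: "v + y \<in> E" "v + z \<in> E" by (auto simp: G_def F_def add.commute)
      have "y \<in> Zn" "z \<in> Zn" using fl(1) \<open>y \<in> I\<close> \<open>z \<in> I\<close> by (auto simp: I_def)
      then have "(v + y) - (v + z) \<in> Zn" by (simp add: Zn_def)
      from inj[OF e this] \<open>y \<noteq> z\<close> show False by simp
    qed
  qed
  also have "\<dots> \<le> measure lebesgue C"
    using G(1) C finI by (intro measure_mono_fmeasurable) (auto simp: G_def F_def fmeasurableD)
  finally show ?thesis using C by simp
qed

text \<open>The preimage \<open>E\<close> of the ball under \<open>h\<close> has measure greater
  than 1, so by Blichfeldt's principle it contains two distinct points with integral difference. The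
  image of that difference under \<open>h\<close> is a difference of two points of the ball.\<close>

lemma minkowski_ball_wo:
  fixes h :: "real ^ ('n :: {finite,wellorder}) ^ ('n :: {finite,wellorder})"
  assumes "det h \<noteq> 0" "\<bar>det h\<bar> < measure lebesgue (ball (0 :: real ^ ('n :: {finite,wellorder})) r)"
  obtains z where "z \<in> Zn" "z \<noteq> 0" "norm (h *v z) < 2 * r"
proof (rule ccontr)
  assume no: "\<not> thesis"
  obtain h' where h': "h' ** h = mat 1" "h ** h' = mat 1"
    using assms(1) invertible_det_nz[of h] by (auto simp: invertible_def)
  define E where "E = (*v) h' ` ball 0 r"
  have "measure lebesgue E \<le> 1"
  proof (rule measure_le_1_of_disjoint_translates)
    have "ball 0 r \<in> lmeasurable" by simp
    then show "E \<in> sets lebesgue"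
      unfolding E_def using measurable_linear_image[OF matrix_vector_mul_linear] fmeasurableD by blast
    show "bounded E"
      unfolding E_def by (intro bounded_linear_image) (auto intro: matrix_vector_mul_bounded_linear)
    fix v w assume vw: "v \<in> E" "w \<in> E" "v - w \<in> Zn"
    then obtain a b where ab: "v = h' *v a" "w = h' *v b" "norm a < r" "norm b < r"
      by (auto simp: E_def)
    have "h *v (v - w) = a - b"
      by (simp add: ab(1,2) matrix_vector_mult_diff_distrib matrix_vector_mul_assoc h')
    then have "norm (h *v (v - w)) < 2 * r"
      using norm_triangle_ineq4[of a b] ab(3,4) by simp
    with no that vw(3) show "v = w" by force
  qed
  moreover have "measure lebesgue E = \<bar>det h'\<bar> * measure lebesgue (ball (0 :: real ^ ('n :: {finite,wellorder})) r)"
    unfolding E_def using measure_linear_image[OF matrix_vector_mul_linear[of h'], of "ball 0 r"] by simp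
  moreover have "\<bar>det h'\<bar> * \<bar>det h\<bar> = 1"
    using arg_cong[OF h'(1), of det] by (simp add: det_mul flip: abs_mult)
  ultimately have "\<bar>det h'\<bar> * measure lebesgue (ball (0 :: real ^ ('n :: {finite,wellorder})) r) \<le> \<bar>det h'\<bar> * \<bar>det h\<bar>"
    and "0 < \<bar>det h'\<bar>"
    by auto
  then show False
    using assms(2) by simp
qed

text \<open>The constant is the volume of the ball of radius \<open>r / 2\<close>, hence independent
  of \<open>h\<close>. Renaming the indices along \<open>Rep_wo\<close> preserves determinants,
  norms and integrality, which reduces the claim to the well-ordered copy.\<close>

lemma minkowski_ball:
  fixes r :: real
  assumes "r > 0"
  obtains c where "c > 0"
    "\<And>h :: real ^ 'n ^ 'n. det h \<noteq> 0 \<Longrightarrow> \<bar>det h\<bar> < c \<Longrightarrow> \<exists>z\<in>Zn. z \<noteq> 0 \<and> norm (h *v z) < r"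
proof
  let ?c = "measure lebesgue (ball (0 :: real ^ 'n wo) (r / 2))"
  show "?c > 0" using assms content_ball_pos[of "r/2" "0 :: real ^ 'n wo"] by simp
  fix h :: "real ^ 'n ^ 'n"
  assume h: "det h \<noteq> 0" "\<bar>det h\<bar> < ?c"
  have bij: "bij (Rep_wo :: 'n wo \<Rightarrow> 'n)"
    by (metis Abs_wo_inverse Rep_wo_inverse UNIV_I bijI')
  define k where "k = (\<chi> i j. h $ Rep_wo i $ Rep_wo (j :: 'n wo))"
  have "det k = det h" unfolding k_def by (rule det_reindex[OF bij])
  with h obtain y where y: "y \<in> Zn" "y \<noteq> 0" "norm (k *v y) < r"
    using minkowski_ball_wo[of k "r / 2"] by auto
  define z where "z = (\<chi> i. y $ Abs_wo i)"
  have y_z: "y $ i = z $ Rep_wo i" for i by (simp add: z_def Rep_wo_inverse)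
  have "(k *v y) $ i = (h *v z) $ Rep_wo i" for i
    using sum.reindex_bij_betw[OF bij, of "\<lambda>j. h $ Rep_wo i $ j * z $ j"]
    by (simp add: matrix_vector_mult_def k_def y_z)
  then have "norm (k *v y) = norm (h *v z)"
    using sum.reindex_bij_betw[OF bij, of "\<lambda>i. ((h *v z) $ i)\<^sup>2"]
    by (simp add: norm_vec_def L2_set_def)
  moreover have "z \<in> Zn" using y(1) by (simp add: Zn_def z_def)
  moreover have "z \<noteq> 0" using y(2) by (auto simp: y_z vec_eq_iff)
  ultimately show "\<exists>z\<in>Zn. z \<noteq> 0 \<and> norm (h *v z) < r" using y(3) by auto
qed

section \<open>Mahler's compactness criterion\<close>

text \<open>Otherwise some unit vector \<open>u\<close> is orthogonal to all lattice vectors of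
  length at most \<open>s * \<epsilon>\<close>. Compressing the direction \<open>u\<close> by the
  factor \<open>s\<close> makes the determinant small enough for Minkowski's theorem. The vector
  found has length at most \<open>s * \<epsilon>\<close> before compression, so it is orthogonal to
  \<open>u\<close> and the compression leaves it unchanged; hence it is shorter than
  \<open>\<epsilon>\<close>, a contradiction.\<close>

lemma span_short_lattice_vectors:
  fixes \<epsilon> :: real
  assumes "\<epsilon> > 0"
  obtains R where
    "\<And>g :: real ^ 'n ^ 'n. g \<in> SL \<Longrightarrow> (\<And>z. z \<in> Zn \<Longrightarrow> z \<noteq> 0 \<Longrightarrow> \<epsilon> \<le> norm (g *v z)) \<Longrightarrow>
       span {v \<in> lattice_of g. norm v \<le> R} = UNIV"
proof -
  obtain c where "c > 0" and c:
    "\<And>h :: real ^ 'n ^ 'n. det h \<noteq> 0 \<Longrightarrow> \<bar>det h\<bar> < c \<Longrightarrow> \<exists>z\<in>Zn. z \<noteq> 0 \<and> norm (h *v z) < \<epsilon>"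
    using minkowski_ball[OF assms] by blast
  \<comment> \<open>The compressed lattice will have determinant \<open>1 / s\<close> up to sign,
    which must lie below Minkowski's threshold \<open>c\<close>.\<close>
  define s where "s = 1 / c + 1"
  have s: "1 \<le> s" "1 / s < c"
    using \<open>c > 0\<close> by (auto simp: s_def field_simps)
  have "span {v \<in> lattice_of g. norm v \<le> s * \<epsilon>} = UNIV"
    if g: "g \<in> SL" and ge: "\<And>z. z \<in> Zn \<Longrightarrow> z \<noteq> 0 \<Longrightarrow> \<epsilon> \<le> norm (g *v z)" for g :: "real ^ 'n ^ 'n"
  proof (rule ccontr)
    let ?S = "{v \<in> lattice_of g. norm v \<le> s * \<epsilon>}"
    assume "span ?S \<noteq> UNIV"
    then have "dim ?S < DIM(real ^ 'n)"
      using dim_eq_full[of ?S] dim_subset_UNIV[of ?S] by linarith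
    then obtain u0 where u0: "u0 \<noteq> 0" "\<And>y. y \<in> span ?S \<Longrightarrow> orthogonal u0 y"
      by (rule orthogonal_to_subspace_exists) (rule that)
    define u where "u = u0 /\<^sub>R norm u0"
    have "norm u = 1" using u0(1) by (simp add: u_def)
    then obtain k A where A: "orthogonal_matrix A" "A *v axis k 1 = u"
      using orthogonal_matrix_exists_basis by metis
    \<comment> \<open>After the orthogonal change of coordinates by \<open>transpose A\<close>, the
      direction \<open>u\<close> becomes the \<open>k\<close>-th axis, and \<open>D\<close>
      compresses exactly this axis.\<close>
    define D :: "real ^ 'n ^ 'n" where "D = (\<chi> i j. if i = j then (if i = k then 1 / s else 1) else 0)"
    have D: "(D *v y) $ i = (if i = k then y $ k / s else y $ i)" for y i
      by (simp add: D_def matrix_vector_mult_def if_distrib[where f = "\<lambda>a. a * _"] cong: if_cong)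
    have "det D = (\<Prod>i\<in>UNIV. if i = k then 1 / s else 1)"
      by (subst det_diagonal) (auto simp: D_def)
    then have detD: "det D = 1 / s" by simp
    define h where "h = D ** (transpose A ** g)"
    have deth: "\<bar>det h\<bar> = 1 / s"
      using det_orthogonal_matrix[OF A(1)] g s(1) by (auto simp: h_def det_mul detD SL_def)
    then have "det h \<noteq> 0" "\<bar>det h\<bar> < c" using s by auto
    then obtain z where z: "z \<in> Zn" "z \<noteq> 0" "norm (h *v z) < \<epsilon>"
      using c[of h] by blast
    define y where "y = transpose A *v (g *v z)"
    have ny: "norm y = norm (g *v z)"
      unfolding y_def using A(1) orthogonal_transformation_norm[of "(*v) (transpose A)"]
      by (simp add: orthogonal_transformation_matrix)
    have hz: "h *v z = D *v y"
      by (simp add: h_def y_def matrix_vector_mul_assoc)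
    have "y $ k = axis k 1 \<bullet> y" by (simp add: inner_axis')
    also have "\<dots> = u \<bullet> (g *v z)"
      unfolding y_def A(2)[symmetric] transpose_matrix_vector by (metis dot_lmul_matrix inner_commute)
    finally have yk: "y $ k = u \<bullet> (g *v z)" .
    have "norm y \<le> norm (s *\<^sub>R (D *v y))"
      using s(1) by (intro norm_le_componentwise_cart) (auto simp: D abs_mult intro: mult_right_mono[of 1 s, simplified])
    then have "norm (g *v z) \<le> s * norm (h *v z)" using s(1) by (simp add: hz ny)
    also have "\<dots> \<le> s * \<epsilon>" using s(1) z(3) by simp
    finally have "g *v z \<in> ?S" using z(1) by (auto simp: lattice_of_def)
    then have "u \<bullet> (g *v z) = 0"
      using u0(2)[OF span_base] by (simp add: orthogonal_def u_def)
    then have "D *v y = y" by (auto simp: vec_eq_iff D yk)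
    then show False using z ge[of z] by (simp add: hz ny)
  qed
  then show thesis by (rule that)
qed

lemma norm_matrix_le:
  fixes V :: "real ^ 'n ^ 'm"
  assumes "\<And>j. norm (column j V) \<le> R"
  shows "norm V \<le> real CARD('m) * (real CARD('n) * R)"
proof -
  have "norm V \<le> (\<Sum>i\<in>UNIV. norm (V $ i))"
    unfolding norm_vec_def by (rule L2_set_le_sum) simp
  also have "\<dots> \<le> (\<Sum>i\<in>UNIV. \<Sum>j\<in>UNIV. \<bar>V $ i $ j\<bar>)"
    by (intro sum_mono norm_le_l1_cart)
  also have "\<dots> \<le> (\<Sum>i\<in>(UNIV :: 'm set). \<Sum>j\<in>(UNIV :: 'n set). R)"
  proof (intro sum_mono)
    fix i :: 'm and j :: 'n
    show "\<bar>V $ i $ j\<bar> \<le> R"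
      using component_le_norm_cart[of "column j V" i] assms[of j] by (simp add: column_def)
  qed
  finally show ?thesis by simp
qed

text \<open>Choose a basis of the space among the short lattice vectors; their integer coordinates
  with respect to \<open>g\<close> are the columns of \<open>M\<close>. The chosen vectors need not
  generate the lattice, so \<open>det M\<close> is only known to be nonzero.\<close>

lemma short_integer_matrix:
  fixes \<epsilon> :: real
  assumes "\<epsilon> > 0"
  obtains R where
    "\<And>g :: real ^ 'n ^ 'n. g \<in> SL \<Longrightarrow> (\<And>z. z \<in> Zn \<Longrightarrow> z \<noteq> 0 \<Longrightarrow> \<epsilon> \<le> norm (g *v z)) \<Longrightarrow>
       \<exists>M. (\<forall>i j. M $ i $ j \<in> \<int>) \<and> det M \<noteq> 0 \<and> norm (g ** M) \<le> R"
proof -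
  obtain R where R:
    "\<And>g :: real ^ 'n ^ 'n. g \<in> SL \<Longrightarrow> (\<And>z. z \<in> Zn \<Longrightarrow> z \<noteq> 0 \<Longrightarrow> \<epsilon> \<le> norm (g *v z)) \<Longrightarrow>
       span {v \<in> lattice_of g. norm v \<le> R} = UNIV"
    using span_short_lattice_vectors[OF assms] by blast
  have "\<exists>M. (\<forall>i j. M $ i $ j \<in> \<int>) \<and> det M \<noteq> 0 \<and> norm (g ** M) \<le> real CARD('n) * (real CARD('n) * R)"
    if g: "g \<in> SL" and ge: "\<And>z. z \<in> Zn \<Longrightarrow> z \<noteq> 0 \<Longrightarrow> \<epsilon> \<le> norm (g *v z)" for g :: "real ^ 'n ^ 'n"
  proof -
    let ?S = "{v \<in> lattice_of g. norm v \<le> R}"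
    have S: "span ?S = UNIV" using R[OF g ge] by blast
    obtain B where B: "B \<subseteq> ?S" "independent B" "?S \<subseteq> span B" "card B = dim ?S"
      by (rule basis_exists)
    have spB: "span B = UNIV"
      using span_minimal[OF B(3) subspace_span] S by auto
    have "card B = CARD('n)"
      using B(4) S dim_eq_full[of ?S] by simp
    moreover have "finite B" using B(2) by (rule independent_imp_finite)
    ultimately obtain f where f: "bij_betw f (UNIV :: 'n set) B"
      using finite_same_card_bij[OF finite[of "UNIV :: 'n set"], of B] by auto
    have fS: "f j \<in> ?S" for j
      using B(1) bij_betwE[OF f] by blast
    then have fR: "norm (f j) \<le> R" for j by simp
    have "\<exists>z. z \<in> Zn \<and> g *v z = f j" for j
      using fS[of j] by (force simp: lattice_of_def)
    then obtain \<zeta> where \<zeta>: "\<And>j. \<zeta> j \<in> Zn" "\<And>j. g *v \<zeta> j = f j"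
      by metis
    define M where "M = (\<chi> i j. \<zeta> j $ i)"
    have col: "column j (g ** M) = f j" for j
    proof -
      have "column j (g ** M) = g *v \<zeta> j"
        by (simp add: column_def M_def matrix_matrix_mult_def vec_eq_iff matrix_vector_mult_def)
      then show ?thesis by (simp only: \<zeta>(2))
    qed
    have "columns (g ** M) = B"
      using f by (auto simp: columns_def col bij_betw_def)
    then have "\<exists>H. (g ** M) ** H = mat 1"
      by (simp add: matrix_right_invertible_span_columns span_vec_eq spB)
    then have "det (g ** M) \<noteq> 0"
      using invertible_det_nz invertible_right_inverse by blast
    then have "det M \<noteq> 0" by (simp add: det_mul)
    moreover have "M $ i $ j \<in> \<int>" for i j using \<zeta>(1) by (simp add: M_def Zn_def)
    moreover have "norm (g ** M) \<le> real CARD('n) * (real CARD('n) * R)"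
      by (intro norm_matrix_le) (simp add: col fR)
    ultimately show ?thesis by blast
  qed
  then show thesis by (rule that)
qed

section \<open>Integer matrices of bounded determinant modulo SL(n, Z)\<close>

text \<open>With \<open>J\<close> the inverse of \<open>M\<^sub>0\<close>, the quotient
  \<open>M ** J\<close> equals the identity plus the product of \<open>(M - M\<^sub>0) / N\<close>
  and \<open>N * J\<close>. The first factor is integral by the congruence, the second is the
  adjugate of \<open>M\<^sub>0\<close>.\<close>

lemma SLZ_factor_of_cong:
  fixes M M\<^sub>0 :: "real ^ 'n ^ 'n"
  assumes "\<And>i j. M\<^sub>0 $ i $ j \<in> \<int>" and N: "det M = N" "det M\<^sub>0 = N" "N \<noteq> 0"
    and cong: "\<And>i j. (M $ i $ j - M\<^sub>0 $ i $ j) / N \<in> \<int>"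
  shows "\<exists>\<gamma>\<in>SLZ. M = \<gamma> ** M\<^sub>0"
proof -
  obtain J where J: "M\<^sub>0 ** J = mat 1" "J ** M\<^sub>0 = mat 1"
    using N invertible_det_nz[of M\<^sub>0] by (auto simp: invertible_def)
  \<comment> \<open>Integrality of the adjugate: Cramer's rule expresses each column of
    \<open>J\<close> by determinants of integer matrices divided by \<open>N\<close>.\<close>
  have NJ: "N * J $ k $ j \<in> \<int>" for k j
  proof -
    have "M\<^sub>0 *v column j J = column j (M\<^sub>0 ** J)"
      by (simp add: matrix_vector_mult_basis[symmetric] matrix_vector_mul_assoc)
    also have "\<dots> = axis j 1" by (simp add: J(1) matrix_vector_mult_basis[symmetric])
    finally have "M\<^sub>0 *v column j J = axis j 1" .
    then have "column j J = (\<chi> k. det (\<chi> i l. if l = k then axis j 1 $ i else M\<^sub>0 $ i $ l) / det M\<^sub>0)"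
      using N by (subst (asm) cramer) auto
    then have "J $ k $ j = det (\<chi> i l. if l = k then axis j 1 $ i else M\<^sub>0 $ i $ l) / N"
      unfolding vec_eq_iff using N by (simp add: column_def)
    then have "N * J $ k $ j = det (\<chi> i l. if l = k then axis j 1 $ i else M\<^sub>0 $ i $ l)"
      using N by simp
    moreover have "\<dots> \<in> \<int>"
      using assms(1) by (intro Ints_det) (auto simp: axis_def)
    ultimately show ?thesis by simp
  qed
  define \<gamma> where "\<gamma> = M ** J"
  have "(M - M\<^sub>0) ** J = M ** J - M\<^sub>0 ** J"
    by (simp add: matrix_matrix_mult_def vec_eq_iff sum_subtractf left_diff_distrib)
  then have "\<gamma> = mat 1 + (M - M\<^sub>0) ** J"
    by (simp add: \<gamma>_def J)
  moreover have "((M - M\<^sub>0) ** J) $ i $ j \<in> \<int>" for i j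
  proof -
    have "((M - M\<^sub>0) ** J) $ i $ j = (\<Sum>k\<in>UNIV. ((M $ i $ k - M\<^sub>0 $ i $ k) / N) * (N * J $ k $ j))"
      using N by (simp add: matrix_matrix_mult_def)
    also have "\<dots> \<in> \<int>"
      by (intro Ints_sum Ints_mult cong NJ)
    finally show ?thesis .
  qed
  ultimately have "\<gamma> $ i $ j \<in> \<int>" for i j
    by (auto simp: mat_def)
  moreover have "det \<gamma> = 1"
    using arg_cong[OF J(1), of det] N by (simp add: \<gamma>_def det_mul)
  moreover have "M = \<gamma> ** M\<^sub>0"
    by (simp add: \<gamma>_def J flip: matrix_mul_assoc)
  ultimately show ?thesis by (auto simp: SLZ_def SL_def)
qed

text \<open>Two matrices with the same determinant \<open>N\<close> and the same entries modulo
  \<open>N\<close> differ by a left factor in \<open>SLZ\<close>. For bounded nonzero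
  \<open>N\<close> there are finitely many such data, and \<open>F\<close> holds one matrix for each
  that occurs.\<close>

lemma finite_integer_matrices_mod_SLZ:
  obtains F :: "(real ^ 'n ^ 'n) set" where "finite F" "\<And>M. M \<in> F \<Longrightarrow> det M \<noteq> 0"
    "\<And>M. (\<And>i j. M $ i $ j \<in> \<int>) \<Longrightarrow> det M \<noteq> 0 \<Longrightarrow> \<bar>det M\<bar> \<le> D \<Longrightarrow> \<exists>\<gamma>\<in>SLZ. \<exists>M\<^sub>0\<in>F. M = \<gamma> ** M\<^sub>0"
proof -
  define S :: "(real ^ 'n ^ 'n) set" where
    "S = {M. (\<forall>i j. M $ i $ j \<in> \<int>) \<and> det M \<noteq> 0 \<and> \<bar>det M\<bar> \<le> D}"
  define key where "key M = (\<lfloor>det M\<rfloor>, \<chi> i j. \<lfloor>M $ i $ j\<rfloor> mod \<lfloor>det M\<rfloor>)" for M :: "real ^ 'n ^ 'n"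
  have detI: "of_int \<lfloor>det M\<rfloor> = det M" if "M \<in> S" for M
    using that Ints_det[of M] by (auto simp: S_def elim: Ints_cases)
  let ?T = "{-\<lceil>D\<rceil>..\<lceil>D\<rceil>}"
  have "key ` S \<subseteq> ?T \<times> {v. \<forall>i. v $ i \<in> {w. \<forall>j. w $ j \<in> ?T}}"
  proof
    fix x assume "x \<in> key ` S"
    then obtain M where M: "M \<in> S" "x = key M" by blast
    have "\<bar>real_of_int \<lfloor>det M\<rfloor>\<bar> \<le> D" "\<lfloor>det M\<rfloor> \<noteq> 0"
      using detI[OF M(1)] M(1) by (auto simp: S_def)
    then have d: "\<bar>\<lfloor>det M\<rfloor>\<bar> \<le> \<lceil>D\<rceil>" "\<lfloor>det M\<rfloor> \<noteq> 0" by linarith+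
    \<comment> \<open>A remainder takes the sign of the divisor, and the determinant may be
      negative; hence the symmetric range \<open>?T\<close>.\<close>
    have "\<bar>a mod \<lfloor>det M\<rfloor>\<bar> \<le> \<lceil>D\<rceil>" for a
      using abs_mod_less[OF d(2), of a] d(1) by linarith
    then have "a mod \<lfloor>det M\<rfloor> \<in> ?T" for a by (simp add: abs_le_iff minus_le_iff)
    then show "x \<in> ?T \<times> {v. \<forall>i. v $ i \<in> {w. \<forall>j. w $ j \<in> ?T}}"
      using d(1) by (auto simp: M key_def abs_le_iff minus_le_iff)
  qed
  then have fin: "finite (key ` S)"
    by (rule finite_subset) (intro finite_cartesian_product finite_vec_range finite_atLeastAtMost_int)
  define F where "F = inv_into S key ` (key ` S)"
  show thesis
  proof
    show "finite F" using fin by (simp add: F_def)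
    have FS: "F \<subseteq> S" by (auto simp: F_def intro: inv_into_into)
    then show "det M \<noteq> 0" if "M \<in> F" for M using that by (auto simp: S_def)
    fix M :: "real ^ 'n ^ 'n" assume "\<And>i j. M $ i $ j \<in> \<int>" "det M \<noteq> 0" "\<bar>det M\<bar> \<le> D"
    then have M: "M \<in> S" by (simp add: S_def)
    define M\<^sub>0 where "M\<^sub>0 = inv_into S key (key M)"
    have M0: "M\<^sub>0 \<in> F" "M\<^sub>0 \<in> S" "key M\<^sub>0 = key M"
      using M FS by (auto simp: M\<^sub>0_def F_def f_inv_into_f)
    have "\<lfloor>det M\<^sub>0\<rfloor> = \<lfloor>det M\<rfloor>"
      using M0(3) by (simp add: key_def)
    then have eq: "det M\<^sub>0 = det M"
      using detI[OF M] detI[OF M0(2)] by metis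
    have "(M $ i $ j - M\<^sub>0 $ i $ j) / det M \<in> \<int>" for i j
    proof -
      have "\<lfloor>M $ i $ j\<rfloor> mod \<lfloor>det M\<rfloor> = \<lfloor>M\<^sub>0 $ i $ j\<rfloor> mod \<lfloor>det M\<rfloor>"
        using M0(3) by (simp add: key_def vec_eq_iff eq)
      then obtain q where "\<lfloor>M $ i $ j\<rfloor> - \<lfloor>M\<^sub>0 $ i $ j\<rfloor> = \<lfloor>det M\<rfloor> * q"
        by (metis mod_eq_dvd_iff dvdE)
      then have "real_of_int (\<lfloor>M $ i $ j\<rfloor> - \<lfloor>M\<^sub>0 $ i $ j\<rfloor>) = det M * of_int q"
        using detI[OF M] by simp
      moreover have "of_int \<lfloor>M $ i $ j\<rfloor> = M $ i $ j" "of_int \<lfloor>M\<^sub>0 $ i $ j\<rfloor> = M\<^sub>0 $ i $ j"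
        using M M0(2) by (auto simp: S_def)
      ultimately have "(M $ i $ j - M\<^sub>0 $ i $ j) / det M = of_int q"
        using M by (simp add: S_def)
      then show ?thesis by simp
    qed
    then have "\<exists>\<gamma>\<in>SLZ. M = \<gamma> ** M\<^sub>0"
      using M M0(2) eq by (intro SLZ_factor_of_cong[of M\<^sub>0 M "det M"]) (auto simp: S_def)
    then show "\<exists>\<gamma>\<in>SLZ. \<exists>M\<^sub>0\<in>F. M = \<gamma> ** M\<^sub>0" using M0(1) by blast
  qed
qed

section \<open>Mahler's criterion: lattices without short vectors lie in a compact set\<close>

lemma continuous_on_det: "continuous_on S (det :: real ^ 'n ^ 'n \<Rightarrow> real)"
  unfolding det_def by (intro continuous_intros)

lemma continuous_on_matrix_mult_right:
  "continuous_on S (\<lambda>V :: real ^ 'n ^ 'm. V ** (B :: real ^ 'k ^ 'n))"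
  unfolding matrix_matrix_mult_def by (intro continuous_intros)

lemma SL_mult: "g \<in> SL \<Longrightarrow> h \<in> SL \<Longrightarrow> g ** h \<in> SL"
  by (simp add: SL_def det_mul)

text \<open>Take \<open>M\<close> with \<open>g ** M\<close> bounded and write
  \<open>M = \<gamma> ** M\<^sub>0\<close> with \<open>M\<^sub>0\<close> from a finite set. Then
  \<open>g ** \<gamma>\<close> is \<open>g ** M\<close> times the inverse of
  \<open>M\<^sub>0\<close>, so it lies in a fixed compact set and represents the same lattice as
  \<open>g\<close>.\<close>

lemma mahler_compactness:
  fixes \<epsilon> :: real
  assumes "\<epsilon> > 0"
  obtains K :: "(real ^ 'n) set set" where "compactin lattice_space K"
    "\<And>g. g \<in> SL \<Longrightarrow> (\<And>v. v \<in> lattice_of g \<Longrightarrow> v \<noteq> 0 \<Longrightarrow> \<epsilon> \<le> norm v) \<Longrightarrow> lattice_of g \<in> K"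
proof -
  obtain R where R:
    "\<And>g :: real ^ 'n ^ 'n. g \<in> SL \<Longrightarrow> (\<And>z. z \<in> Zn \<Longrightarrow> z \<noteq> 0 \<Longrightarrow> \<epsilon> \<le> norm (g *v z)) \<Longrightarrow>
       \<exists>M. (\<forall>i j. M $ i $ j \<in> \<int>) \<and> det M \<noteq> 0 \<and> norm (g ** M) \<le> R"
    using short_integer_matrix[OF assms] by blast
  \<comment> \<open>Since \<open>det g = 1\<close>, a bound for the determinant on the ball of
    radius \<open>R\<close> also bounds \<open>det M\<close> whenever \<open>g ** M\<close> lies in
    that ball.\<close>
  have "bounded (det ` cball (0 :: real ^ 'n ^ 'n) R)"
    by (intro compact_imp_bounded compact_continuous_image continuous_on_det) simp
  then obtain D where "\<forall>V\<in>cball (0 :: real ^ 'n ^ 'n) R. \<bar>det V\<bar> \<le> D"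
    by (auto simp: bounded_iff)
  then have D: "\<bar>det V\<bar> \<le> D" if "norm V \<le> R" for V :: "real ^ 'n ^ 'n"
    using that by simp
  obtain F :: "(real ^ 'n ^ 'n) set" where F: "finite F" "\<And>M. M \<in> F \<Longrightarrow> det M \<noteq> 0"
    "\<And>M. (\<And>i j. M $ i $ j \<in> \<int>) \<Longrightarrow> det M \<noteq> 0 \<Longrightarrow> \<bar>det M\<bar> \<le> D \<Longrightarrow> \<exists>\<gamma>\<in>SLZ. \<exists>M\<^sub>0\<in>F. M = \<gamma> ** M\<^sub>0"
    by (rule finite_integer_matrices_mod_SLZ[of D]) (rule that; blast)
  have "\<forall>M\<in>F. \<exists>J. M ** J = mat 1"
    using F(2) invertible_det_nz invertible_right_inverse by blast
  then obtain J where J: "\<And>M. M \<in> F \<Longrightarrow> M ** J M = mat 1" by metis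
  define C where "C = SL \<inter> (\<Union>M\<in>F. (\<lambda>V. V ** J M) ` cball 0 R)"
  have "closed (SL :: (real ^ 'n ^ 'n) set)"
    unfolding SL_def using continuous_closed_preimage_constant[OF continuous_on_det closed_UNIV, of 1]
    by simp
  then have "compact C"
    unfolding C_def using F(1)
    by (intro closed_Int_compact compact_UN compact_continuous_image continuous_on_matrix_mult_right) auto
  show thesis
  proof
    have "compactin (top_of_set SL) C"
      using \<open>compact C\<close> by (simp add: compactin_subtopology C_def)
    then show "compactin lattice_space (lattice_of ` C)"
      by (rule image_compactin) (rule quotient_imp_continuous_map[OF quotient_map_lattice_of])
    fix g :: "real ^ 'n ^ 'n"
    assume g: "g \<in> SL" and ge: "\<And>v. v \<in> lattice_of g \<Longrightarrow> v \<noteq> 0 \<Longrightarrow> \<epsilon> \<le> norm v"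
    have "g *v z \<noteq> 0" if "z \<noteq> 0" for z
      using that g matrix_left_invertible_ker[of g] invertible_det_nz[of g]
      by (auto simp: SL_def invertible_left_inverse)
    then have "\<epsilon> \<le> norm (g *v z)" if "z \<in> Zn" "z \<noteq> 0" for z
      using that by (intro ge) (auto simp: lattice_of_def)
    from R[OF g this] obtain M where M: "\<And>i j. M $ i $ j \<in> \<int>" "det M \<noteq> 0" "norm (g ** M) \<le> R"
      by blast
    have "\<bar>det M\<bar> \<le> D" using D[OF M(3)] g by (simp add: det_mul SL_def)
    with F(3) M obtain \<gamma> M\<^sub>0 where \<gamma>: "\<gamma> \<in> SLZ" "M\<^sub>0 \<in> F" "M = \<gamma> ** M\<^sub>0" by blast
    have "g ** \<gamma> = (g ** M) ** J M\<^sub>0"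
      using J[OF \<gamma>(2)] by (simp add: \<gamma>(3) flip: matrix_mul_assoc)
    moreover have "g ** \<gamma> \<in> SL" using g \<gamma>(1) by (auto simp: SLZ_def intro: SL_mult)
    ultimately have "g ** \<gamma> \<in> C" using \<gamma>(2) M(3) by (auto simp: C_def intro!: bexI[of _ M\<^sub>0])
    moreover have "lattice_of (g ** \<gamma>) = lattice_of g"
      using lattice_of_eq_iff[OF g \<open>g ** \<gamma> \<in> SL\<close>] \<gamma>(1) by auto
    ultimately show "lattice_of g \<in> lattice_of ` C" by (metis imageI)
  qed
qed

section \<open>Mahler's criterion: compact sets of lattices avoid short vectors\<close>

text \<open>A quotient by a group action is an open map: the matrices whose lattice lies in the
  image of \<open>U\<close> form the union of the preimages of \<open>U\<close> under right
  multiplication by elements of \<open>SLZ\<close>, each of which is open in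
  \<open>SL\<close>.\<close>

lemma openin_lattice_of_image:
  fixes U :: "(real ^ 'n ^ 'n) set"
  assumes U: "openin (top_of_set SL) U"
  shows "openin lattice_space (lattice_of ` U)"
proof -
  have USL: "U \<subseteq> SL" using openin_subset[OF U] by simp
  have "{g \<in> SL. lattice_of g \<in> lattice_of ` U} = (\<Union>\<gamma>\<in>SLZ. SL \<inter> (\<lambda>g. g ** \<gamma>) -` U)"
  proof (intro equalityI subsetI)
    fix g assume "g \<in> {g \<in> SL. lattice_of g \<in> lattice_of ` U}"
    then obtain h where g: "g \<in> SL" and h: "h \<in> U" "lattice_of g = lattice_of h" by blast
    then obtain \<gamma> where "\<gamma> \<in> SLZ" "h = g ** \<gamma>"
      using lattice_of_eq_iff[of g h] USL by blast
    then show "g \<in> (\<Union>\<gamma>\<in>SLZ. SL \<inter> (\<lambda>g. g ** \<gamma>) -` U)" using g h(1) by blast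
  next
    fix g assume "g \<in> (\<Union>\<gamma>\<in>SLZ. SL \<inter> (\<lambda>g. g ** \<gamma>) -` U)"
    then obtain \<gamma> where \<gamma>: "\<gamma> \<in> SLZ" "g \<in> SL" "g ** \<gamma> \<in> U" by blast
    then have "lattice_of g = lattice_of (g ** \<gamma>)"
      using lattice_of_eq_iff[of g "g ** \<gamma>"] USL by blast
    then show "g \<in> {g \<in> SL. lattice_of g \<in> lattice_of ` U}" using \<gamma> by blast
  qed
  moreover have "openin (top_of_set SL) (SL \<inter> (\<lambda>g. g ** \<gamma>) -` U)" if "\<gamma> \<in> SLZ" for \<gamma>
    using that by (intro continuous_openin_preimage[OF continuous_on_matrix_mult_right _ U])
      (auto simp: SLZ_def intro: SL_mult)
  ultimately have "openin (top_of_set SL) {g \<in> SL. lattice_of g \<in> lattice_of ` U}"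
    by (simp only:) (intro openin_Union; blast)
  then show ?thesis
    using USL unfolding openin_lattice_space by auto
qed

lemma norm_matrix_vector_mult_le:
  fixes A :: "real ^ 'n ^ 'm"
  shows "norm (A *v x) \<le> real CARD('m) * norm A * norm x"
proof -
  have "norm (A *v x) \<le> (\<Sum>i\<in>UNIV. \<bar>(A *v x) $ i\<bar>)" by (rule norm_le_l1_cart)
  also have "\<dots> \<le> (\<Sum>i\<in>(UNIV :: 'm set). norm A * norm x)"
  proof (rule sum_mono)
    fix i
    have "\<bar>(A *v x) $ i\<bar> \<le> norm (A $ i) * norm x"
      unfolding matrix_vector_mul_component by (rule Cauchy_Schwarz_ineq2)
    also have "\<dots> \<le> norm A * norm x"
      by (intro mult_right_mono Finite_Cartesian_Product.norm_nth_le) simp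
    finally show "\<bar>(A *v x) $ i\<bar> \<le> norm A * norm x" .
  qed
  finally show ?thesis by simp
qed

lemma norm_ge_1_of_Zn:
  assumes "z \<in> Zn" "z \<noteq> 0"
  shows "1 \<le> norm z"
proof -
  obtain i where "z $ i \<noteq> 0" using assms(2) by (auto simp: vec_eq_iff)
  then have "1 \<le> \<bar>z $ i\<bar>" using assms(1) by (intro Ints_nonzero_abs_ge1) (auto simp: Zn_def)
  then show ?thesis using component_le_norm_cart[of z i] by linarith
qed

text \<open>The injective map \<open>g\<^sub>0\<close> stretches every vector by at least some
  \<open>B > 0\<close>, and matrices close to it still stretch by at least \<open>B / 2\<close>.
  Nonzero integer vectors have norm at least 1, so \<open>B / 2\<close> bounds the nonzero lattice
  vectors from below.\<close>

lemma openin_nhd_without_short_vectors: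
  fixes g\<^sub>0 :: "real ^ 'n ^ 'n"
  assumes "g\<^sub>0 \<in> SL"
  obtains U \<epsilon> where "openin lattice_space U" "lattice_of g\<^sub>0 \<in> U" "\<epsilon> > 0"
    "\<And>L v. L \<in> U \<Longrightarrow> v \<in> L \<Longrightarrow> v \<noteq> 0 \<Longrightarrow> \<epsilon> \<le> norm v"
proof -
  have "inj ((*v) g\<^sub>0)"
    using assms invertible_det_nz[of g\<^sub>0] inj_matrix_vector_mult by (auto simp: SL_def)
  then obtain B where B: "B > 0" "\<And>x. B * norm x \<le> norm (g\<^sub>0 *v x)"
    using linear_inj_bounded_below_pos[OF matrix_vector_mul_linear] by metis
  let ?N = "real CARD('n)"
  \<comment> \<open>Chosen so that the crude operator norm bound for a matrix of norm below
    \<open>r\<close> is \<open>B / 2\<close>.\<close>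
  define r where "r = B / (2 * ?N)"
  have "?N > 0" by simp
  then have r: "r > 0" "?N * r = B / 2" using B(1) by (simp_all add: r_def)
  show thesis
  proof
    show "openin lattice_space (lattice_of ` (SL \<inter> ball g\<^sub>0 r))"
      by (intro openin_lattice_of_image openin_open_Int) simp
    show "lattice_of g\<^sub>0 \<in> lattice_of ` (SL \<inter> ball g\<^sub>0 r)" using assms r(1) by simp
    show "B / 2 > 0" using B(1) by simp
    fix L and v :: "real ^ 'n"
    assume "L \<in> lattice_of ` (SL \<inter> ball g\<^sub>0 r)" "v \<in> L" "v \<noteq> 0"
    then obtain g z where g: "norm (g\<^sub>0 - g) < r" and z: "z \<in> Zn" "v = g *v z"
      by (auto simp: lattice_of_def dist_norm)
    have "z \<noteq> 0" using \<open>v \<noteq> 0\<close> z by auto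
    have "norm ((g\<^sub>0 - g) *v z) \<le> ?N * norm (g\<^sub>0 - g) * norm z"
      by (rule norm_matrix_vector_mult_le)
    also have "\<dots> \<le> ?N * r * norm z"
      using g by (intro mult_right_mono mult_left_mono) auto
    finally have "norm (g\<^sub>0 *v z - g *v z) \<le> B / 2 * norm z"
      by (simp only: r(2) matrix_vector_mult_diff_rdistrib)
    then have "B / 2 * norm z \<le> norm v"
      using B(2)[of z] norm_triangle_ineq2[of "g\<^sub>0 *v z" "g *v z"] z(2) by simp
    moreover have "B / 2 \<le> B / 2 * norm z"
      using norm_ge_1_of_Zn[OF z(1) \<open>z \<noteq> 0\<close>] B(1) by simp
    ultimately show "B / 2 \<le> norm v" by linarith
  qed
qed

text \<open>Cover \<open>K\<close> by open sets with a common lower bound for nonzero vectors, pass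
  to a finite subcover and take the least of its bounds.\<close>

lemma compactin_lattice_space_no_short_vectors:
  assumes K: "compactin lattice_space (K :: (real ^ 'n) set set)"
  obtains \<epsilon> where "\<epsilon> > 0" "\<And>L v. L \<in> K \<Longrightarrow> v \<in> L \<Longrightarrow> v \<noteq> 0 \<Longrightarrow> \<epsilon> \<le> norm v"
proof -
  define no_short where "no_short \<epsilon> L \<longleftrightarrow> (\<forall>v\<in>L. v \<noteq> 0 \<longrightarrow> \<epsilon> \<le> norm v)" for \<epsilon> and L :: "(real ^ 'n) set"
  define \<U> where "\<U> = {U. openin lattice_space U \<and> (\<exists>\<epsilon>>0. \<forall>L\<in>U. no_short \<epsilon> L)}"
  have "K \<subseteq> \<Union>\<U>"
  proof
    fix L assume "L \<in> K"
    then obtain g where "g \<in> SL" "L = lattice_of g"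
      using compactin_subset_topspace[OF K] by (auto simp: topspace_lattice_space)
    then obtain U \<epsilon> where U: "openin lattice_space U" "L \<in> U" "\<epsilon> > 0"
      and "\<And>L v. L \<in> U \<Longrightarrow> v \<in> L \<Longrightarrow> v \<noteq> 0 \<Longrightarrow> \<epsilon> \<le> norm v"
      using openin_nhd_without_short_vectors[of g] by metis
    then have "\<forall>L\<in>U. no_short \<epsilon> L" by (simp add: no_short_def)
    with U have "U \<in> \<U>" unfolding \<U>_def by blast
    with U(2) show "L \<in> \<Union>\<U>" by blast
  qed
  moreover have "\<forall>U\<in>\<U>. openin lattice_space U" by (simp add: \<U>_def)
  ultimately obtain \<F> where \<F>: "finite \<F>" "\<F> \<subseteq> \<U>" "K \<subseteq> \<Union>\<F>"
    using K unfolding compactin_def by meson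
  have "\<forall>U\<in>\<F>. \<exists>\<epsilon>>0. \<forall>L\<in>U. no_short \<epsilon> L" using \<F>(2) by (auto simp: \<U>_def)
  then obtain e where e: "\<And>U. U \<in> \<F> \<Longrightarrow> e U > 0" "\<And>U L. U \<in> \<F> \<Longrightarrow> L \<in> U \<Longrightarrow> no_short (e U) L"
    by metis
  \<comment> \<open>The element 1 keeps the minimum meaningful when the subcover is empty.\<close>
  define \<epsilon> where "\<epsilon> = Min (insert 1 (e ` \<F>))"
  show thesis
  proof
    show "\<epsilon> > 0" unfolding \<epsilon>_def using \<F>(1) e(1) by auto
    fix L v assume "L \<in> K" "v \<in> L" "v \<noteq> (0 :: real ^ 'n)"
    then obtain U where U: "U \<in> \<F>" "L \<in> U" using \<F>(3) by blast
    then have "e U \<le> norm v" using e(2) \<open>v \<in> L\<close> \<open>v \<noteq> 0\<close> by (auto simp: no_short_def)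
    moreover have "\<epsilon> \<le> e U" unfolding \<epsilon>_def using \<F>(1) U(1) by (intro Min_le) auto
    ultimately show "\<epsilon> \<le> norm v" by linarith
  qed
qed

section \<open>Singular vectors and divergent orbits\<close>

lemma sum_option:
  fixes f :: "'a::finite option \<Rightarrow> 'b::comm_monoid_add"
  shows "(\<Sum>j\<in>UNIV. f j) = f None + (\<Sum>i\<in>UNIV. f (Some i))"
  by (simp add: UNIV_option_conv sum.reindex)

lemma prod_option:
  fixes f :: "'a::finite option \<Rightarrow> 'b::comm_monoid_mult"
  shows "(\<Prod>j\<in>UNIV. f j) = f None * (\<Prod>i\<in>UNIV. f (Some i))"
  by (simp add: UNIV_option_conv prod.reindex)

lemma a_mat_mult_nth: "(a_mat w t *v v) $ j = a_mat w t $ j $ j * v $ j"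
  by (simp add: a_mat_def matrix_vector_mult_def if_distrib[where f = "\<lambda>a. a * _"] cong: if_cong)

text \<open>For \<open>z = (-p, q)\<close> these are \<open>exp (- t) * q\<close> and
  \<open>exp (w $ i * t)\<close> times the \<open>i\<close>-th coordinate of \<open>q x - p\<close>:
  exactly the quantities that singularity controls.\<close>

lemma orbit_vector:
  "(a_mat w t *v (u_mat x *v z)) $ None = exp (- t) * z $ None"
  "(a_mat w t *v (u_mat x *v z)) $ Some i = exp (w $ i * t) * (z $ Some i + x $ i * z $ None)"
  unfolding a_mat_mult_nth
  by (simp_all add: a_mat_def u_mat_def matrix_vector_mult_def sum_option
      if_distrib[where f = "\<lambda>a. a * _"] add.commute cong: if_cong)

lemma a_mat_in_SL:
  assumes "weight w"
  shows "a_mat w t \<in> SL"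
proof -
  have "det (a_mat w t) = (\<Prod>j\<in>UNIV. a_mat w t $ j $ j)"
    by (rule det_diagonal) (simp add: a_mat_def)
  also have "\<dots> = exp (- t) * exp (\<Sum>i\<in>UNIV. w $ i * t)"
    by (simp add: prod_option a_mat_def exp_sum)
  also have "(\<Sum>i\<in>UNIV. w $ i * t) = t"
    using assms by (simp add: weight_def flip: sum_distrib_right)
  finally show ?thesis by (simp add: SL_def flip: exp_add)
qed

text \<open>The transpose of \<open>u_mat x\<close> arises from the identity by adding a combination
  of the other rows to the row \<open>None\<close>, which preserves the determinant.\<close>

lemma u_mat_in_SL:
  fixes x :: "real ^ 'd"
  shows "u_mat x \<in> SL"
proof -
  define X :: "real ^ ('d option)" where "X = (\<Sum>i\<in>UNIV. x $ i *s row (Some i) (mat 1))"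
  have "X \<in> vec.span {row j (mat 1 :: real ^ ('d option) ^ ('d option)) | j. j \<noteq> None}"
    unfolding X_def by (intro vec.span_sum vec.span_scale vec.span_base) blast
  then have "det (\<chi> j. if j = None then row None (mat 1) + X else row j (mat 1)) = det (mat 1 :: real ^ ('d option) ^ ('d option))"
    by (rule det_row_span)
  moreover have "(\<chi> j. if j = None then row None (mat 1) + X else row j (mat 1)) = transpose (u_mat x)"
    by (auto simp: vec_eq_iff X_def row_def mat_def transpose_def u_mat_def
        if_distrib[where f = "\<lambda>a. _ * a"] split: option.splits cong: if_cong)
  ultimately show ?thesis by (simp add: SL_def)
qed

text \<open>Each coordinate attains a positive minimum on \<open>W\<close>, and there are finitely
  many coordinates. The bound makes the exponents \<open>w $ i / m\<close> at least 1 for all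
  weights simultaneously.\<close>

lemma compact_proper_weights_bounded_below:
  fixes W :: "(real ^ 'd) set"
  assumes "\<And>w. w \<in> W \<Longrightarrow> proper_weight w" "compact W"
  obtains m where "m > 0" "\<And>w i. w \<in> W \<Longrightarrow> m \<le> w $ i"
proof (cases "W = {}")
  case True
  then show ?thesis using that[of 1] by simp
next
  case False
  have "\<exists>m>0. \<forall>w\<in>W. m \<le> w $ i" for i
  proof -
    have "continuous_on W (\<lambda>w. w $ i)" by (intro continuous_intros)
    from continuous_attains_inf[OF assms(2) False this] show ?thesis
      using assms(1) by (auto simp: proper_weight_def)
  qed
  then obtain m where m: "\<And>i. m i > 0" "\<And>i w. w \<in> W \<Longrightarrow> m i \<le> w $ i" by metis
  show ?thesis
  proof
    show "Min (range m) > 0" using m(1) by simp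
    show "Min (range m) \<le> w $ i" if "w \<in> W" for w i
      using order.trans[OF Min_le[of "range m" "m i"] m(2)[OF that, of i]] by simp
  qed
qed

lemma continuous_on_a_mat:
  "continuous_on S (\<lambda>(w, t). a_mat w t)"
proof -
  have "continuous_on S (\<lambda>p. a_mat (fst p) (snd p) $ i $ j)" for i j
    by (cases "i = j"; cases i) (auto simp: a_mat_def intro!: continuous_intros)
  then have "continuous_on S (\<lambda>p. \<chi> i j. a_mat (fst p) (snd p) $ i $ j)"
    by (intro continuous_on_vec_lambda)
  then show ?thesis by (simp add: case_prod_unfold)
qed

section \<open>From singularity to divergence\<close>

text \<open>A solution for \<open>Q = \<eta> * exp t\<close> gives a nonzero vector of the
  translated lattice that is too short for a lattice in \<open>K\<close>, as soon as
  \<open>t > T\<close>. Compactness of \<open>W\<close> provides the uniform bound \<open>m\<close>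
  and makes the exceptional set, given by \<open>t\<close> in \<open>[0, T]\<close>,
  compact.\<close>

lemma W_singular_imp_orbit_diverges:
  fixes W :: "(real ^ 'd) set"
  assumes proper: "\<And>w. w \<in> W \<Longrightarrow> proper_weight w" and "compact W" and sing: "W_singular W x"
  shows "orbit_diverges (A_plus W) (lattice_of (u_mat x))"
  unfolding orbit_diverges_def
proof (intro allI impI)
  fix K :: "(real ^ ('d option)) set set"
  assume "compactin lattice_space K"
  then obtain \<epsilon> where \<epsilon>: "\<epsilon> > 0" "\<And>L v. L \<in> K \<Longrightarrow> v \<in> L \<Longrightarrow> v \<noteq> 0 \<Longrightarrow> \<epsilon> \<le> norm v"
    using compactin_lattice_space_no_short_vectors by blast
  obtain m where m: "m > 0" "\<And>w i. w \<in> W \<Longrightarrow> m \<le> w $ i"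
    by (rule compact_proper_weights_bounded_below[OF proper \<open>compact W\<close>]) (assumption | rule that)+
  define N where "N = real CARD('d option)"
  \<comment> \<open>Coordinates of size at most \<open>\<eta>\<close> force norm below
    \<open>\<epsilon>\<close>; in addition \<open>\<eta> \<le> 1\<close> makes its powers decrease
    in the exponent.\<close>
  define \<eta> where "\<eta> = min (1 / 2) (\<epsilon> / (2 * N))"
  have N: "N > 0" by (simp add: N_def)
  have \<eta>: "\<eta> > 0" "\<eta> \<le> 1" using \<epsilon>(1) N by (auto simp: \<eta>_def)
  have "N * \<eta> \<le> N * (\<epsilon> / (2 * N))"
    using N by (intro mult_left_mono) (auto simp: \<eta>_def)
  also have "\<dots> = \<epsilon> / 2" using N by simp
  finally have N\<eta>: "N * \<eta> < \<epsilon>" using \<epsilon>(1) by linarith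
  \<comment> \<open>With \<open>Q = \<eta> * exp t\<close> this gives
    \<open>exp t * (\<delta> / Q) = \<eta> powr (1 / m)\<close>, whose power with exponent
    \<open>w $ i \<ge> m\<close> is at most \<open>\<eta>\<close>.\<close>
  define \<delta> where "\<delta> = \<eta> * \<eta> powr (1 / m)"
  have "\<delta> > 0" using \<eta> by (simp add: \<delta>_def)
  with sing obtain Q0 where Q0: "Q0 > 0" "\<forall>Q>Q0. \<forall>w\<in>W. \<exists>(p :: int ^ 'd) (q :: nat).
      wnorm w (real q *\<^sub>R x - (\<chi> i. real_of_int (p $ i))) \<le> \<delta> / Q \<and> 0 < q \<and> real q \<le> Q"
    unfolding W_singular_def by meson
  \<comment> \<open>The threshold beyond which \<open>\<eta> * exp t\<close> exceeds
    \<open>Q0\<close>.\<close>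
  define T where "T = ln (Q0 / \<eta>)"
  define A' where "A' = (\<lambda>(w, t). a_mat w t) ` (W \<times> {0..T})"
  show "\<exists>A'. compactin (top_of_set (A_plus W)) A' \<and>
      (\<forall>a\<in>A_plus W - A'. (*v) a ` lattice_of (u_mat x) \<notin> K)"
  proof (intro exI conjI ballI notI)
    have "compact A'"
      unfolding A'_def by (intro compact_continuous_image continuous_on_a_mat compact_Times \<open>compact W\<close>) simp
    then show "compactin (top_of_set (A_plus W)) A'"
      by (auto simp: compactin_subtopology A'_def A_plus_def) blast
    fix a assume "a \<in> A_plus W - A'" and inK: "(*v) a ` lattice_of (u_mat x) \<in> K"
    then obtain w t where wt: "a = a_mat w t" "w \<in> W" "T < t"
      by (force simp: A_plus_def A'_def)
    \<comment> \<open>The factor \<open>\<eta>\<close> turns \<open>q \<le> Q\<close> into the bound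
      \<open>\<eta>\<close> for the last coordinate \<open>exp (- t) * q\<close>.\<close>
    define Q where "Q = \<eta> * exp t"
    have "Q0 / \<eta> < exp t"
      using wt(3) Q0(1) \<eta>(1) unfolding T_def by (metis divide_pos_pos exp_less_cancel_iff exp_ln)
    then have "Q > Q0" using \<eta>(1) by (simp add: Q_def field_simps)
    from Q0(2)[rule_format, OF this wt(2)] obtain p :: "int ^ 'd" and q :: nat where
      pq: "wnorm w (real q *\<^sub>R x - (\<chi> i. real_of_int (p $ i))) \<le> \<delta> / Q" "0 < q" "real q \<le> Q"
      by blast
    define z :: "real ^ ('d option)"
      where "z = (\<chi> j. case j of None \<Rightarrow> real q | Some i \<Rightarrow> - real_of_int (p $ i))"
    have "z \<in> Zn" by (auto simp: z_def Zn_def split: option.splits)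
    define v where "v = a *v (u_mat x *v z)"
    have vNone: "v $ None = exp (- t) * real q"
      by (simp add: v_def wt(1) orbit_vector z_def)
    have vSome: "v $ Some i = exp (w $ i * t) * (real q * x $ i - real_of_int (p $ i))" for i
      by (simp add: v_def wt(1) orbit_vector z_def algebra_simps)
    have "\<bar>v $ None\<bar> \<le> \<eta>"
    using pq(3) by (simp add: vNone Q_def exp_minus field_simps)
    moreover have "\<bar>v $ Some i\<bar> \<le> \<eta>" for i
    proof -
      define y where "y = \<bar>real q * x $ i - real_of_int (p $ i)\<bar>"
      have wi: "w $ i > 0" "m \<le> w $ i" using proper[OF wt(2)] m(2)[OF wt(2)] by (auto simp: proper_weight_def)
      have "y powr (1 / w $ i) \<le> wnorm w (real q *\<^sub>R x - (\<chi> i. real_of_int (p $ i)))"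
        unfolding wnorm_def y_def using wi by (intro Max_ge) auto
      also note pq(1)
      finally have "(y powr (1 / w $ i)) powr (w $ i) \<le> (\<delta> / Q) powr (w $ i)"
        using wi by (intro powr_mono2) auto
      then have "y \<le> (\<delta> / Q) powr (w $ i)"
        using wi by (simp add: powr_powr y_def)
      then have "exp (w $ i * t) * y \<le> exp (w $ i * t) * (\<delta> / Q) powr (w $ i)" by simp
      also have "\<dots> = (exp t * (\<delta> / Q)) powr (w $ i)"
        using \<open>\<delta> > 0\<close> \<eta>(1) by (subst powr_mult) (auto simp: Q_def powr_def)
      also have "exp t * (\<delta> / Q) = \<eta> powr (1 / m)"
        using \<eta>(1) by (simp add: Q_def \<delta>_def)
      also have "(\<eta> powr (1 / m)) powr (w $ i) = \<eta> powr (w $ i / m)"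
        by (simp add: powr_powr)
      also have "\<dots> \<le> \<eta> powr 1"
        using \<eta> m(1) wi by (intro powr_mono') (auto simp: field_simps)
      finally show ?thesis using \<eta>(1) by (simp add: vSome y_def abs_mult)
    qed
    ultimately have "\<bar>v $ j\<bar> \<le> \<eta>" for j by (cases j) auto
    then have "(\<Sum>j\<in>UNIV. \<bar>v $ j\<bar>) \<le> (\<Sum>j\<in>(UNIV :: 'd option set). \<eta>)" by (intro sum_mono) auto
    then have "norm v < \<epsilon>" using norm_le_l1_cart[of v] N\<eta> by (simp add: N_def)
    moreover have "v \<noteq> 0" using vNone pq(2) by (auto simp: vec_eq_iff intro!: exI[of _ None])
    moreover have "v \<in> (*v) a ` lattice_of (u_mat x)"
      using \<open>z \<in> Zn\<close> by (auto simp: v_def lattice_of_def)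
    ultimately show False using \<epsilon>(2)[OF inK] by fastforce
  qed
qed

section \<open>From divergence to singularity\<close>

text \<open>On a compact exceptional set the entry \<open>exp (- t)\<close> is bounded below, so for
  large \<open>Q = exp t\<close> the translated lattice lies outside Mahler's compact set, for every
  \<open>w\<close> in \<open>W\<close>. It then has a nonzero vector shorter than
  \<open>\<epsilon>\<close>, whose integer coordinates are the required
  \<open>(-p, q)\<close>.\<close>

lemma orbit_diverges_imp_W_singular:
  fixes W :: "(real ^ 'd) set"
  assumes proper: "\<And>w. w \<in> W \<Longrightarrow> proper_weight w"
    and div: "orbit_diverges (A_plus W) (lattice_of (u_mat x))"
  shows "W_singular W x"
  unfolding W_singular_def
proof (intro allI impI)
  fix \<delta> :: real assume "\<delta> > 0"
  \<comment> \<open>Besides \<open>\<epsilon> \<le> \<delta>\<close>, a value below 1 is used to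
    exclude \<open>q = 0\<close>, to get
    \<open>\<epsilon> powr (1 / w $ i) \<le> \<epsilon>\<close>, and to obtain
    \<open>q \<le> Q\<close>.\<close>
  define \<epsilon> where "\<epsilon> = min \<delta> (1 / 2)"
  have \<epsilon>: "\<epsilon> > 0" "\<epsilon> \<le> \<delta>" "\<epsilon> \<le> 1 / 2" using \<open>\<delta> > 0\<close> by (auto simp: \<epsilon>_def)
  obtain K :: "(real ^ 'd option) set set" where K: "compactin lattice_space K"
    "\<And>g. g \<in> SL \<Longrightarrow> (\<And>v. v \<in> lattice_of g \<Longrightarrow> v \<noteq> 0 \<Longrightarrow> \<epsilon> \<le> norm v) \<Longrightarrow> lattice_of g \<in> K"
    using mahler_compactness[OF \<epsilon>(1)] by blast
  obtain A' where A': "compactin (top_of_set (A_plus W)) A'"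
    "\<And>a. a \<in> A_plus W - A' \<Longrightarrow> (*v) a ` lattice_of (u_mat x) \<notin> K"
    using div K(1) unfolding orbit_diverges_def by blast
  have cA': "compact A'" "A' \<subseteq> A_plus W" using A'(1) by (auto simp: compactin_subtopology)
  obtain b where b: "b > 0" "\<And>a. a \<in> A' \<Longrightarrow> b \<le> a $ None $ None"
  proof (cases "A' = {}")
    case True
    then show ?thesis using that[of 1] by simp
  next
    case False
    have "continuous_on A' (\<lambda>a. a $ None $ None)" by (intro continuous_intros)
    from continuous_attains_inf[OF cA'(1) False this] obtain a0
      where a0: "a0 \<in> A'" "\<And>a. a \<in> A' \<Longrightarrow> a0 $ None $ None \<le> a $ None $ None" by blast
    moreover have "a0 $ None $ None > 0" using a0(1) cA'(2) by (auto simp: A_plus_def a_mat_def)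
    ultimately show ?thesis by (intro that[of "a0 $ None $ None"])
  qed
  show "\<exists>Q0>0. \<forall>Q>Q0. \<forall>w\<in>W. \<exists>(p :: int ^ 'd) (q :: nat).
       wnorm w (real q *\<^sub>R x - (\<chi> i. real_of_int (p $ i))) \<le> \<delta> / Q \<and> 0 < q \<and> real q \<le> Q"
  \<comment> \<open>\<open>Q > 1\<close> gives \<open>t \<ge> 0\<close>, and
    \<open>Q > 1 / b\<close> gives \<open>exp (- t) < b\<close>, which places the matrix outside
    \<open>A'\<close>.\<close>
  proof (intro exI[of _ "max 1 (1 / b)"] conjI allI impI ballI)
    show "max 1 (1 / b) > 0" by simp
    fix Q w assume Q: "max 1 (1 / b) < Q" and w: "w \<in> W"
    define t where "t = ln Q"
    have t: "t \<ge> 0" "exp t = Q" "exp (- t) = 1 / Q"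
      using Q by (auto simp: t_def exp_minus field_simps)
    define a where "a = a_mat w t"
    have wi: "w $ i > 0" "w $ i < 1" for i
      using proper[OF w] by (auto simp: proper_weight_def)
    have "a $ None $ None < b"
      using Q b(1) by (simp add: a_def a_mat_def t field_simps)
    then have "a \<notin> A'" using b(2) by force
    then have "lattice_of (a ** u_mat x) \<notin> K"
      using A'(2)[of a] w t(1) by (auto simp: a_def A_plus_def lattice_of_mult)
    moreover have "a ** u_mat x \<in> SL"
      using proper[OF w] by (auto simp: a_def proper_weight_def intro: SL_mult a_mat_in_SL u_mat_in_SL)
    ultimately obtain v where v: "v \<in> lattice_of (a ** u_mat x)" "v \<noteq> 0" "norm v < \<epsilon>"
      using K(2) by (meson not_le)
    then obtain z0 where z0: "z0 \<in> Zn" "v = a *v (u_mat x *v z0)"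
      by (auto simp: lattice_of_def matrix_vector_mul_assoc)
    \<comment> \<open>If \<open>q\<close> were 0, the other coordinates would be integers multiplied
      by factors at least 1, so a vector of norm below 1 would vanish.\<close>
    have "z0 $ None \<noteq> 0"
    proof
      assume 0: "z0 $ None = 0"
      have "z0 $ Some i = 0" for i
      proof -
        have "exp (w $ i * t) * \<bar>z0 $ Some i\<bar> < 1"
          using component_le_norm_cart[of v "Some i"] v(3) \<epsilon>(3)
          by (simp add: z0(2) a_def orbit_vector 0 abs_mult)
        moreover have "1 * \<bar>z0 $ Some i\<bar> \<le> exp (w $ i * t) * \<bar>z0 $ Some i\<bar>"
          using wi[of i] t(1) by (intro mult_right_mono) auto
        ultimately have "\<bar>z0 $ Some i\<bar> < 1" by linarith
        then show ?thesis
          using z0(1) Ints_nonzero_abs_ge1[of "z0 $ Some i"] by (force simp: Zn_def)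
      qed
      then have "z0 $ j = 0" for j using 0 by (cases j) auto
      then have "z0 = 0" by (simp add: vec_eq_iff)
      then show False using v(2) z0(2) by simp
    qed
    \<comment> \<open>Replacing the vector by its negative, if necessary, makes \<open>q\<close>
      positive.\<close>
    then obtain z where z: "z \<in> Zn" "z $ None > 0" and vz: "norm (a *v (u_mat x *v z)) < \<epsilon>"
    proof (cases "z0 $ None > 0")
      case True
      then show ?thesis using that[of z0] z0 v(3) by simp
    next
      case False
      have "a *v (u_mat x *v (- z0)) = - v" by (simp add: z0(2) linear_neg[OF matrix_vector_mul_linear])
      then show ?thesis using that[of "- z0"] z0 v(3) False \<open>z0 $ None \<noteq> 0\<close> by (simp add: Zn_def)
    qed
    define q where "q = nat \<lfloor>z $ None\<rfloor>"
    define p where "p = (\<chi> i. - \<lfloor>z $ Some i\<rfloor>)"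
    have q: "real q = z $ None" and p: "real_of_int (p $ i) = - z $ Some i" for i
      using z by (auto simp: q_def p_def Zn_def elim!: Ints_cases)
    have comp: "\<bar>(a *v (u_mat x *v z)) $ j\<bar> < \<epsilon>" for j
      using component_le_norm_cart[of "a *v (u_mat x *v z)" j] vz by linarith
    have "\<bar>real q * x $ i - real_of_int (p $ i)\<bar> powr (1 / w $ i) \<le> \<delta> / Q" for i
    proof -
      define y where "y = \<bar>real q * x $ i - real_of_int (p $ i)\<bar>"
      have "exp (w $ i * t) * y < \<epsilon>"
        using comp[of "Some i"] by (simp add: a_def orbit_vector abs_mult y_def p q add.commute mult.commute)
      then have "(exp (w $ i * t) * y) powr (1 / w $ i) \<le> \<epsilon> powr (1 / w $ i)"
        using wi[of i] by (intro powr_mono2) (auto simp: y_def)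
      also have "\<dots> \<le> \<epsilon> powr 1"
        using \<epsilon> wi[of i] by (intro powr_mono') (auto simp: field_simps)
      \<comment> \<open>Taking the power \<open>1 / w $ i\<close> turns
        \<open>exp (w $ i * t)\<close> into \<open>exp t = Q\<close>, the same factor for all
        coordinates.\<close>
      also have "(exp (w $ i * t) * y) powr (1 / w $ i) = Q * y powr (1 / w $ i)"
        using wi[of i] t(2) by (subst powr_mult) (auto simp: y_def powr_def)
      finally have "Q * y powr (1 / w $ i) \<le> \<delta>" using \<epsilon> by simp
      then show ?thesis using Q by (simp add: y_def field_simps)
    qed
    moreover have "{i. w $ i \<noteq> 0} = UNIV" using wi by (metis (mono_tags) UNIV_eq_I less_irrefl mem_Collect_eq)
    ultimately have "wnorm w (real q *\<^sub>R x - (\<chi> i. real_of_int (p $ i))) \<le> \<delta> / Q"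
      unfolding wnorm_def by (subst Max_le_iff) auto
    moreover have "0 < q" using z(2) q by linarith
    moreover have "real q \<le> Q"
    proof -
      have "real q / Q < \<epsilon>" using comp[of None] z(2) Q by (simp add: a_def orbit_vector t q)
      then have "real q / Q < 1" using \<epsilon>(3) by linarith
      then show ?thesis using Q by (simp add: field_simps)
    qed
    ultimately show "\<exists>(p :: int ^ 'd) (q :: nat).
       wnorm w (real q *\<^sub>R x - (\<chi> i. real_of_int (p $ i))) \<le> \<delta> / Q \<and> 0 < q \<and> real q \<le> Q" by blast
  qed
qed

theorem theorem4p3:
  fixes W :: "(real ^ 'd) set" and x :: "real ^ 'd"
  assumes "\<And>w. w \<in> W \<Longrightarrow> proper_weight w"
    and "compact W"
  shows "W_singular W x \<longleftrightarrow> orbit_diverges (A_plus W) (lattice_of (u_mat x))"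
  using W_singular_imp_orbit_diverges[OF assms] orbit_diverges_imp_W_singular[OF assms(1)] by blast

end
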